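(* The D$(3^4,6)$ lattice is total-threshold-colorable with $O(|V|)$ threshold and $O(|V|)$ colors: there is a constant $C$ such that every finite induced subgraph $G=(V,E)$ of the D$(3^4,6)$ lattice is $(r,t)$-total-threshold-colorable for some $r,t\le C|V|$.
   Context: An edge labeling of a graph $G=(V,E)$ is a map $l:E\to\{N,F\}$. A threshold-coloring of $G$ with respect to $l$ is a map $c:V\to\mathbb{Z}$ with an integer $t\ge0$ such that for every edge $(u,v)$, $|c(u)-c(v)|\le t$ iff $l(u,v)=N$; if $m,M$ are the minimum and maximum of $c$, any integer $r>M-m$ is a range (number of colors), and $c$ is an $(r,t)$-threshold-coloring. $G$ is $(r,t)$-total-threshold-colorable if for every edge labeling there is an $(r,t)$-threshold-coloring with respect to it. The D$(3^4,6)$ lattice is the planar dual graph of the snub hexagonal tiling (the Archimedean tiling with vertex species $(3,3,3,3,6)$), i.e. the floret pentagonal tiling graph, with vertices of degree 3 and 6. *)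

theory Defs
  imports Complex_Main
begin

section \<open>Threshold-colorings\<close>

text \<open>A graph is given by its vertex set and its set of edges, an edge being the
  two-element set of its ends. Labels outside the edge set and colors outside the
  vertex set are irrelevant.\<close>

datatype label = N | F

definition threshold_coloring ::
    "'a set \<Rightarrow> 'a set set \<Rightarrow> ('a set \<Rightarrow> label) \<Rightarrow> int \<Rightarrow> ('a \<Rightarrow> int) \<Rightarrow> bool" where
  "threshold_coloring V E l t c \<longleftrightarrow>
     0 \<le> t \<and> (\<forall>u\<in>V. \<forall>v\<in>V. {u, v} \<in> E \<longrightarrow> (\<bar>c u - c v\<bar> \<le> t \<longleftrightarrow> l {u, v} = N))"

text \<open>Meant for finite \<open>V\<close>, so that \<open>Max\<close> and \<open>Min\<close> are meaningful; the empty
  coloring has no maximum and minimum, so it imposes no condition on \<open>r\<close>.\<close>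

definition rt_threshold_coloring ::
    "int \<Rightarrow> int \<Rightarrow> 'a set \<Rightarrow> 'a set set \<Rightarrow> ('a set \<Rightarrow> label) \<Rightarrow> ('a \<Rightarrow> int) \<Rightarrow> bool" where
  "rt_threshold_coloring r t V E l c \<longleftrightarrow>
     threshold_coloring V E l t c \<and> (V \<noteq> {} \<longrightarrow> r > Max (c ` V) - Min (c ` V))"

definition total_threshold_colorable ::
    "int \<Rightarrow> int \<Rightarrow> 'a set \<Rightarrow> 'a set set \<Rightarrow> bool" where
  "total_threshold_colorable r t V E \<longleftrightarrow> (\<forall>l. \<exists>c. rt_threshold_coloring r t V E l c)"

definition induced_edges :: "'a set set \<Rightarrow> 'a set \<Rightarrow> 'a set set" where
  "induced_edges E V = {e \<in> E. e \<subseteq> V}"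

section \<open>The snub hexagonal tiling\<close>

text \<open>The pair \<open>(a, b)\<close> stands for the point \<open>a + b\<omega>\<close> of the plane with
  \<open>\<omega> = exp (i\<pi>/3)\<close>. All these points, joined at distance 1, form the triangular tiling.
  The six neighbours of the origin take the values 1, ..., 6 of \<open>a + 3b\<close> modulo 7, so
  the points with value 0 form a sublattice of index 7 and every other point has exactly
  one neighbour in it. Deleting this sublattice merges the six triangles around
  each deleted point into a hexagon and leaves four triangles and one
  hexagon at every remaining point: this is the snub hexagonal tiling (its mirror image
  has an isomorphic graph).\<close>

definition tri_adj :: "int \<times> int \<Rightarrow> int \<times> int \<Rightarrow> bool" where
  "tri_adj p q \<longleftrightarrow>
     (fst q - fst p, snd q - snd p) \<in> {(1, 0), (0, 1), (-1, 1), (-1, 0), (0, -1), (1, -1)}"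

definition hex_center :: "int \<times> int \<Rightarrow> bool" where
  "hex_center p \<longleftrightarrow> (fst p + 3 * snd p) mod 7 = 0"

definition snub_verts :: "(int \<times> int) set" where
  "snub_verts = {p. \<not> hex_center p}"

definition snub_edges :: "(int \<times> int) set set" where
  "snub_edges = {{p, q} | p q. p \<in> snub_verts \<and> q \<in> snub_verts \<and> tri_adj p q}"

text \<open>A face is represented by the set of its corners.\<close>

definition snub_triangles :: "(int \<times> int) set set" where
  "snub_triangles =
     {{p, q, s} | p q s. p \<in> snub_verts \<and> q \<in> snub_verts \<and> s \<in> snub_verts \<and>
        tri_adj p q \<and> tri_adj q s \<and> tri_adj p s}"

definition snub_hexagons :: "(int \<times> int) set set" where
  "snub_hexagons = {{q. tri_adj p q} | p. hex_center p}"

definition snub_faces :: "(int \<times> int) set set" where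
  "snub_faces = snub_triangles \<union> snub_hexagons"

section \<open>The dual lattice\<close>

text \<open>Edges of the planar dual of a tiling with edge set \<open>E\<close> and face set \<open>Fs\<close>: pairs of
  faces with a common edge. Testing \<open>e \<subseteq> f\<close> for an edge \<open>e\<close> of the snub hexagonal
  tiling amounts to \<open>e\<close> being a side of \<open>f\<close>, since no edge is a
  diagonal of a face; two distinct faces have at most one common edge, so the
  dual has no parallel edges.\<close>

definition dual_edges :: "'a set set \<Rightarrow> 'a set set \<Rightarrow> 'a set set set" where
  "dual_edges E Fs =
     {{f, g} | f g. f \<in> Fs \<and> g \<in> Fs \<and> f \<noteq> g \<and> (\<exists>e\<in>E. e \<subseteq> f \<and> e \<subseteq> g)}"

definition D346_verts :: "(int \<times> int) set set" where
  "D346_verts = snub_faces"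

definition D346_edges :: "(int \<times> int) set set set" where
  "D346_edges = dual_edges snub_edges snub_faces"

end

theory Submission
  imports Defs "HOL-Library.Product_Lexorder"
begin

text \<open>Each triangle of the snub hexagonal tiling either meets a hexagon in a side or has three
  triangular neighbours; call these types \<open>A\<close> and \<open>B\<close>, and call the hexagons \<open>H\<close>. In the dual, an
  \<open>A\<close> has one neighbour of each type, so the edges fall apart into disjoint groups of five: an
  edge \<open>A - A'\<close>, with \<open>A\<close> joined to some \<open>H\<close> and \<open>B\<close> and with \<open>A'\<close> joined to some \<open>H'\<close> and \<open>B'\<close>.

  Give the hexagons colors \<open>h\<close> slightly above \<open>0\<close> and the \<open>B\<close>-triangles colors \<open>b\<close> slightly
  above \<open>t\<close>. For most labelings of a group, colors for \<open>A\<close> and \<open>A'\<close> exist if \<open>b > h' + t\<close> and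
  \<open>b' > h + t\<close>; for the three remaining ones they exist if one of these inequalities is strictly
  reversed. So it suffices to order the hexagons and \<open>B\<close>-triangles linearly with \<open>H' < B\<close> and
  \<open>H < B'\<close> for the former groups, and \<open>B < H'\<close> or \<open>B' < H\<close> for the latter, and to
  use ranks as heights; hence the linear number of colors. In two of the three directions of groups
  we reverse \<open>H < B'\<close>, in the third one \<open>H' < B\<close>. Then, sorting by rows, all unreversed inequalities
  between different rows point the same way, and inside a row the comparisons form a zigzag path
  with pendant vertices, on which any orientation is acyclic.\<close>

section \<open>Indexing the faces and the groups of dual edges\<close>

text \<open>\<open>Hx\<close> is indexed by the centre of the hexagon, \<open>Up\<close> and \<open>Dn\<close> by the left corner of the
  horizontal side of the triangle. With \<open>v = (a + 3 * b) mod 7\<close>, the \<open>B\<close>-triangles are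
  \<open>Up\<close> with \<open>v = 1\<close> and \<open>Dn\<close> with \<open>v = 5\<close>.\<close>

datatype node = Hx int int | Up int int | Dn int int

fun face :: "node \<Rightarrow> (int \<times> int) set" where
  "face (Hx a b) = {q. tri_adj (a, b) q}"
| "face (Up a b) = {(a, b), (a + 1, b), (a, b + 1)}"
| "face (Dn a b) = {(a, b), (a + 1, b), (a + 1, b - 1)}"

fun valid :: "node \<Rightarrow> bool" where
  "valid (Hx a b) \<longleftrightarrow> (a + 3 * b) mod 7 = 0"
| "valid (Up a b) \<longleftrightarrow> (a + 3 * b) mod 7 \<in> {1, 2, 3, 5}"
| "valid (Dn a b) \<longleftrightarrow> (a + 3 * b) mod 7 \<in> {1, 3, 4, 5}"

text \<open>The groups of edges around the \<open>B\<close>-triangle \<open>Up a b\<close>, one for each of its three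
  neighbours; only \<open>(a + 3 * b) mod 7 = 1\<close> is meaningful.\<close>

datatype dir = Al | Be | Ga

fun nodeH :: "dir \<Rightarrow> int \<Rightarrow> int \<Rightarrow> node" where
  "nodeH Al a b = Hx (a + 2) (b - 1)"
| "nodeH Be a b = Hx (a - 1) b"
| "nodeH Ga a b = Hx a (b + 2)"

fun nodeA :: "dir \<Rightarrow> int \<Rightarrow> int \<Rightarrow> node" where
  "nodeA Al a b = Dn a b"
| "nodeA Be a b = Dn (a - 1) (b + 1)"
| "nodeA Ga a b = Dn a (b + 1)"

fun nodeB :: "dir \<Rightarrow> int \<Rightarrow> int \<Rightarrow> node" where
  "nodeB _ a b = Up a b"

fun nodeA' :: "dir \<Rightarrow> int \<Rightarrow> int \<Rightarrow> node" where
  "nodeA' Al a b = Up a (b - 1)"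
| "nodeA' Be a b = Up (a - 1) (b + 1)"
| "nodeA' Ga a b = Up (a + 1) b"

fun nodeB' :: "dir \<Rightarrow> int \<Rightarrow> int \<Rightarrow> node" where
  "nodeB' Al a b = Dn a (b - 1)"
| "nodeB' Be a b = Dn (a - 2) (b + 2)"
| "nodeB' Ga a b = Dn (a + 1) (b + 1)"

fun nodeH' :: "dir \<Rightarrow> int \<Rightarrow> int \<Rightarrow> node" where
  "nodeH' Al a b = Hx (a - 1) b"
| "nodeH' Be a b = Hx a (b + 2)"
| "nodeH' Ga a b = Hx (a + 2) (b - 1)"

text \<open>Each edge is listed in one order only, so adjacency of faces will read
  \<open>adj x y \<or> adj y x\<close>.\<close>

definition adj :: "node \<Rightarrow> node \<Rightarrow> bool" where
  "adj x y \<longleftrightarrow> (\<exists>k a b. (a + 3 * b) mod 7 = 1 \<and>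
     (x, y) \<in> {(nodeH k a b, nodeA k a b), (nodeA k a b, nodeB k a b), (nodeA k a b, nodeA' k a b),
               (nodeA' k a b, nodeB' k a b), (nodeA' k a b, nodeH' k a b)})"

lemma tri_adj_cases:
  assumes "tri_adj (a, b) q"
  shows "q \<in> {(a + 1, b), (a, b + 1), (a - 1, b + 1), (a - 1, b), (a, b - 1), (a + 1, b - 1)}"
proof -
  obtain c d where q: "q = (c, d)" by (cases q)
  have "(c - a, d - b) \<in> {(1, 0), (0, 1), (- 1, 1), (- 1, 0), (0, - 1), (1, - 1)}"
    using assms by (simp only: tri_adj_def q fst_conv snd_conv)
  then have "c - a = 1 \<and> d - b = 0 \<or> c - a = 0 \<and> d - b = 1 \<or> c - a = - 1 \<and> d - b = 1 \<or>
      c - a = - 1 \<and> d - b = 0 \<or> c - a = 0 \<and> d - b = - 1 \<or> c - a = 1 \<and> d - b = - 1"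
    by (simp only: insert_iff empty_iff prod.inject simp_thms)
  then have "c = a + 1 \<and> d = b \<or> c = a \<and> d = b + 1 \<or> c = a - 1 \<and> d = b + 1 \<or>
      c = a - 1 \<and> d = b \<or> c = a \<and> d = b - 1 \<or> c = a + 1 \<and> d = b - 1"
    by (elim disjE) (simp_all add: algebra_simps)
  then show ?thesis by (simp only: q insert_iff empty_iff prod.inject simp_thms)
qed

text \<open>There are six positions of \<open>q\<close> relative to \<open>p\<close>, and
  \<open>s\<close> is one of the two common neighbours of \<open>p\<close> and \<open>q\<close>. The
  residues allowed by \<open>valid\<close> are those for which no corner of the triangle lies in the
  deleted sublattice.\<close>

lemma snub_face_is_node:
  assumes "f \<in> snub_faces"
  shows "\<exists>x. valid x \<and> face x = f"
proof -
  consider "f \<in> snub_triangles" | "f \<in> snub_hexagons"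
    using assms by (auto simp: snub_faces_def)
  then show ?thesis
  proof cases
    case 1
    then obtain p q s where f: "f = {p, q, s}"
      and v: "p \<in> snub_verts" "q \<in> snub_verts" "s \<in> snub_verts"
      and e: "tri_adj p q" "tri_adj q s" "tri_adj p s"
      by (auto simp: snub_triangles_def)
    obtain a b where p: "p = (a, b)" by (cases p)
    have v': "(i + 3 * j) mod 7 \<noteq> 0" if "(i, j) \<in> f" for i j
      using v that f by (auto simp: snub_verts_def hex_center_def)
    have up: ?thesis if "f = face (Up i j)" for i j
    proof (intro exI conjI)
      have "(i + 3 * j) mod 7 \<noteq> 0" "(i + 1 + 3 * j) mod 7 \<noteq> 0" "(i + 3 * (j + 1)) mod 7 \<noteq> 0"
        using v'[of i j] v'[of "i + 1" j] v'[of i "j + 1"] that by simp_all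
      then have "(i + 3 * j) mod 7 = 1 \<or> (i + 3 * j) mod 7 = 2 \<or> (i + 3 * j) mod 7 = 3 \<or> (i + 3 * j) mod 7 = 5"
        by presburger
      then show "valid (Up i j)" by simp
      show "face (Up i j) = f" using that by simp
    qed
    have dn: ?thesis if "f = face (Dn i j)" for i j
    proof (intro exI conjI)
      have "(i + 3 * j) mod 7 \<noteq> 0" "(i + 1 + 3 * j) mod 7 \<noteq> 0" "(i + 1 + 3 * (j - 1)) mod 7 \<noteq> 0"
        using v'[of i j] v'[of "i + 1" j] v'[of "i + 1" "j - 1"] that by simp_all
      then have "(i + 3 * j) mod 7 = 1 \<or> (i + 3 * j) mod 7 = 3 \<or> (i + 3 * j) mod 7 = 4 \<or> (i + 3 * j) mod 7 = 5"
        by presburger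
      then show "valid (Dn i j)" by simp
      show "face (Dn i j) = f" using that by simp
    qed
    have q: "q \<in> {(a + 1, b), (a, b + 1), (a - 1, b + 1), (a - 1, b), (a, b - 1), (a + 1, b - 1)}"
      using tri_adj_cases[OF e(1)[unfolded p]] .
    obtain c d where s: "s = (c, d)" by (cases s)
    from q consider "q = (a + 1, b)" | "q = (a, b + 1)" | "q = (a - 1, b + 1)"
    | "q = (a - 1, b)" | "q = (a, b - 1)" | "q = (a + 1, b - 1)" by blast
    then show ?thesis
    proof cases
      case 1
      have "s = (a, b + 1) \<or> s = (a + 1, b - 1)"
        using e(2,3) unfolding s p 1 by (auto simp: tri_adj_def)
      then show ?thesis
      proof
        assume "s = (a, b + 1)"
        with 1 show ?thesis by (intro up[of "a" "b"]) (auto simp: f p)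
      next
        assume "s = (a + 1, b - 1)"
        with 1 show ?thesis by (intro dn[of "a" "b"]) (auto simp: f p)
      qed
    next
      case 2
      have "s = (a + 1, b) \<or> s = (a - 1, b + 1)"
        using e(2,3) unfolding s p 2 by (auto simp: tri_adj_def)
      then show ?thesis
      proof
        assume "s = (a + 1, b)"
        with 2 show ?thesis by (intro up[of "a" "b"]) (auto simp: f p)
      next
        assume "s = (a - 1, b + 1)"
        with 2 show ?thesis by (intro dn[of "a - 1" "b + 1"]) (auto simp: f p)
      qed
    next
      case 3
      have "s = (a, b + 1) \<or> s = (a - 1, b)"
        using e(2,3) unfolding s p 3 by (auto simp: tri_adj_def)
      then show ?thesis
      proof
        assume "s = (a, b + 1)"
        with 3 show ?thesis by (intro dn[of "a - 1" "b + 1"]) (auto simp: f p)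
      next
        assume "s = (a - 1, b)"
        with 3 show ?thesis by (intro up[of "a - 1" "b"]) (auto simp: f p)
      qed
    next
      case 4
      have "s = (a - 1, b + 1) \<or> s = (a, b - 1)"
        using e(2,3) unfolding s p 4 by (auto simp: tri_adj_def)
      then show ?thesis
      proof
        assume "s = (a - 1, b + 1)"
        with 4 show ?thesis by (intro up[of "a - 1" "b"]) (auto simp: f p)
      next
        assume "s = (a, b - 1)"
        with 4 show ?thesis by (intro dn[of "a - 1" "b"]) (auto simp: f p)
      qed
    next
      case 5
      have "s = (a - 1, b) \<or> s = (a + 1, b - 1)"
        using e(2,3) unfolding s p 5 by (auto simp: tri_adj_def)
      then show ?thesis
      proof
        assume "s = (a - 1, b)"
        with 5 show ?thesis by (intro dn[of "a - 1" "b"]) (auto simp: f p)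
      next
        assume "s = (a + 1, b - 1)"
        with 5 show ?thesis by (intro up[of "a" "b - 1"]) (auto simp: f p)
      qed
    next
      case 6
      have "s = (a + 1, b) \<or> s = (a, b - 1)"
        using e(2,3) unfolding s p 6 by (auto simp: tri_adj_def)
      then show ?thesis
      proof
        assume "s = (a + 1, b)"
        with 6 show ?thesis by (intro dn[of "a" "b"]) (auto simp: f p)
      next
        assume "s = (a, b - 1)"
        with 6 show ?thesis by (intro up[of "a" "b - 1"]) (auto simp: f p)
      qed
    qed
  next
    case 2
    then obtain p where "f = {q. tri_adj p q}" "hex_center p" by (auto simp: snub_hexagons_def)
    then show ?thesis by (intro exI[of _ "Hx (fst p) (snd p)"]) (auto simp: hex_center_def)
  qed
qed

section \<open>Faces with a common side are joined within a group\<close>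

text \<open>A hexagon containing both ends of a segment is centred at a common neighbour of them,
  that is, at the third corner of one of the two triangles on the segment. The next two lemmas treat
  the other directions of segments.\<close>

lemma nodes_at_edge_1:
  assumes "(a, b) \<in> face x" "(a + 1, b) \<in> face x"
  shows "x \<in> {Up a b, Dn a b, Hx a (b + 1), Hx (a + 1) (b - 1)}"
  using assms by (cases x) (auto simp: tri_adj_def)

lemma nodes_at_edge_2:
  assumes "(a, b) \<in> face x" "(a, b + 1) \<in> face x"
  shows "x \<in> {Up a b, Dn (a - 1) (b + 1), Hx (a + 1) b, Hx (a - 1) (b + 1)}"
  using assms by (cases x) (auto simp: tri_adj_def)

lemma nodes_at_edge_3:
  assumes "(a, b) \<in> face x" "(a - 1, b + 1) \<in> face x"
  shows "x \<in> {Up (a - 1) b, Dn (a - 1) (b + 1), Hx (a - 1) b, Hx a (b + 1)}"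
  using assms by (cases x) (auto simp: tri_adj_def)

lemma adjI:
  assumes "(a + 3 * b) mod 7 = 1"
    and "(x, y) \<in> {(nodeH k a b, nodeA k a b), (nodeA k a b, nodeB k a b), (nodeA k a b, nodeA' k a b),
               (nodeA' k a b, nodeB' k a b), (nodeA' k a b, nodeH' k a b)}"
  shows "adj x y"
  using assms unfolding adj_def by blast

text \<open>The residues for which both triangles are valid make the pair \<open>B - A\<close>,
  \<open>A - A'\<close> and \<open>A' - B'\<close> of some group, in this order. The next two lemmas
  do the same for slanted common sides.\<close>

lemma adj_Up_Dn:
  assumes "valid (Up a b)" "valid (Dn a b)"
  shows "adj (Up a b) (Dn a b) \<or> adj (Dn a b) (Up a b)"
proof -
  consider "(a + 3 * b) mod 7 = 1" | "(a + 3 * b) mod 7 = 3" | "(a + 3 * b) mod 7 = 5"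
    using assms by auto
  then show ?thesis
  proof cases
    case 1 then show ?thesis using adjI[of a b _ _ Al] by simp
  next
    case 2
    then have "((a + 1) + 3 * (b - 1)) mod 7 = 1" by presburger
    then show ?thesis using adjI[of "a + 1" "b - 1" _ _ Be] by simp
  next
    case 3
    then have "(a + 3 * (b + 1)) mod 7 = 1" by presburger
    then show ?thesis using adjI[of a "b + 1" _ _ Al] by simp
  qed
qed

lemma adj_Up_Dn_left:
  assumes "valid (Up a b)" "valid (Dn (a - 1) (b + 1))"
  shows "adj (Up a b) (Dn (a - 1) (b + 1)) \<or> adj (Dn (a - 1) (b + 1)) (Up a b)"
proof -
  have "(a + 3 * b) mod 7 = 1 \<or> (a + 3 * b) mod 7 = 2 \<or> (a + 3 * b) mod 7 = 3 \<or> (a + 3 * b) mod 7 = 5"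
    using assms(1) by auto
  moreover have "(a + 3 * b) mod 7 = 5 \<Longrightarrow> ((a - 1) + 3 * (b + 1)) mod 7 = 0"
    by presburger
  ultimately consider "(a + 3 * b) mod 7 = 1" | "(a + 3 * b) mod 7 = 2" | "(a + 3 * b) mod 7 = 3"
    using assms(2) by force
  then show ?thesis
  proof cases
    case 1 then show ?thesis using adjI[of a b _ _ Be] by simp
  next
    case 2
    then have "((a - 1) + 3 * b) mod 7 = 1" by presburger
    then show ?thesis using adjI[of "a - 1" b _ _ Ga] by simp
  next
    case 3
    then have "((a + 1) + 3 * (b - 1)) mod 7 = 1" by presburger
    then show ?thesis using adjI[of "a + 1" "b - 1" _ _ Be] by simp
  qed
qed

lemma adj_Up_Dn_top:
  assumes "valid (Up a b)" "valid (Dn a (b + 1))"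
  shows "adj (Up a b) (Dn a (b + 1)) \<or> adj (Dn a (b + 1)) (Up a b)"
proof -
  have "(a + 3 * b) mod 7 = 1 \<or> (a + 3 * b) mod 7 = 2 \<or> (a + 3 * b) mod 7 = 5 \<or> (a + 3 * b) mod 7 = 3"
    using assms(1) by auto
  moreover have "(a + 3 * b) mod 7 = 3 \<Longrightarrow> (a + 3 * (b + 1)) mod 7 = 6"
    by presburger
  ultimately consider "(a + 3 * b) mod 7 = 1" | "(a + 3 * b) mod 7 = 2" | "(a + 3 * b) mod 7 = 5"
    using assms(2) by force
  then show ?thesis
  proof cases
    case 1 then show ?thesis using adjI[of a b _ _ Ga] by simp
  next
    case 2
    then have "((a - 1) + 3 * b) mod 7 = 1" by presburger
    then show ?thesis using adjI[of "a - 1" b _ _ Ga] by simp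
  next
    case 3
    then have "(a + 3 * (b + 1)) mod 7 = 1" by presburger
    then show ?thesis using adjI[of a "b + 1" _ _ Al] by simp
  qed
qed

lemma adj_Hx:
  \<comment> \<open>The six sides of a hexagon: it is \<open>H'\<close> in the first three cases and
    \<open>H\<close> in the last three, once for each direction.\<close>
  shows "valid (Hx (a + 1) (b - 1)) \<Longrightarrow> adj (Up a b) (Hx (a + 1) (b - 1)) \<or> adj (Hx (a + 1) (b - 1)) (Up a b)"
  and "valid (Hx (a - 1) (b + 1)) \<Longrightarrow> adj (Up a b) (Hx (a - 1) (b + 1)) \<or> adj (Hx (a - 1) (b + 1)) (Up a b)"
  and "valid (Hx (a + 1) (b + 1)) \<Longrightarrow> adj (Up a b) (Hx (a + 1) (b + 1)) \<or> adj (Hx (a + 1) (b + 1)) (Up a b)"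
  and "valid (Hx a (b + 1)) \<Longrightarrow> adj (Dn a b) (Hx a (b + 1)) \<or> adj (Hx a (b + 1)) (Dn a b)"
  and "valid (Hx (a + 2) (b - 1)) \<Longrightarrow> adj (Dn a b) (Hx (a + 2) (b - 1)) \<or> adj (Hx (a + 2) (b - 1)) (Dn a b)"
  and "valid (Hx a (b - 1)) \<Longrightarrow> adj (Dn a b) (Hx a (b - 1)) \<or> adj (Hx a (b - 1)) (Dn a b)"
proof -
  {
    assume "valid (Hx (a + 1) (b - 1))"
    then have "((a - 1) + 3 * (b)) mod 7 = 1" by (simp, presburger)
    then show "adj (Up a b) (Hx (a + 1) (b - 1)) \<or> adj (Hx (a + 1) (b - 1)) (Up a b)"
      using adjI[of "a - 1" "b" _ _ Ga] by simp
  }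
  {
    assume "valid (Hx (a - 1) (b + 1))"
    then have "((a) + 3 * (b + 1)) mod 7 = 1" by (simp, presburger)
    then show "adj (Up a b) (Hx (a - 1) (b + 1)) \<or> adj (Hx (a - 1) (b + 1)) (Up a b)"
      using adjI[of "a" "b + 1" _ _ Al] by simp
  }
  {
    assume "valid (Hx (a + 1) (b + 1))"
    then have "((a + 1) + 3 * (b - 1)) mod 7 = 1" by (simp, presburger)
    then show "adj (Up a b) (Hx (a + 1) (b + 1)) \<or> adj (Hx (a + 1) (b + 1)) (Up a b)"
      using adjI[of "a + 1" "b - 1" _ _ Be] by simp
  }
  {
    assume "valid (Hx a (b + 1))"
    then have "((a) + 3 * (b - 1)) mod 7 = 1" by (simp, presburger)
    then show "adj (Dn a b) (Hx a (b + 1)) \<or> adj (Hx a (b + 1)) (Dn a b)"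
      using adjI[of "a" "b - 1" _ _ Ga] by simp
  }
  {
    assume "valid (Hx (a + 2) (b - 1))"
    then have "((a) + 3 * (b)) mod 7 = 1" by (simp, presburger)
    then show "adj (Dn a b) (Hx (a + 2) (b - 1)) \<or> adj (Hx (a + 2) (b - 1)) (Dn a b)"
      using adjI[of "a" "b" _ _ Al] by simp
  }
  {
    assume "valid (Hx a (b - 1))"
    then have "((a + 1) + 3 * (b - 1)) mod 7 = 1" by (simp, presburger)
    then show "adj (Dn a b) (Hx a (b - 1)) \<or> adj (Hx a (b - 1)) (Dn a b)"
      using adjI[of "a + 1" "b - 1" _ _ Be] by simp
  }
qed

lemma adj_if_share_edge_1:
  assumes "valid x" "valid y" "x \<noteq> y" "{(a, b), (a + 1, b)} \<subseteq> face x \<inter> face y"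
  shows "adj x y \<or> adj y x"
proof -
  \<comment> \<open>A deleted point is not a corner of a valid triangle, and two deleted points
    cannot face each other across a segment. So each side of the segment contributes only one valid
    face.\<close>
  have no: "\<not> (valid (Up a b) \<and> valid (Hx a (b + 1)))" "\<not> (valid (Dn a b) \<and> valid (Hx (a + 1) (b - 1)))"
    "\<not> (valid (Hx a (b + 1)) \<and> valid (Hx (a + 1) (b - 1)))"
    by (simp, presburger)+
  have "x \<in> {Up a b, Dn a b, Hx a (b + 1), Hx (a + 1) (b - 1)}"
    "y \<in> {Up a b, Dn a b, Hx a (b + 1), Hx (a + 1) (b - 1)}"
    using assms(4) by (intro nodes_at_edge_1; simp)+
  then show ?thesis
    using assms(1-3) no adj_Up_Dn[of a b] adj_Hx(1,4)[of a b]
    by (elim insertE emptyE; metis)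
qed

lemma adj_if_share_edge_2:
  assumes "valid x" "valid y" "x \<noteq> y" "{(a, b), (a, b + 1)} \<subseteq> face x \<inter> face y"
  shows "adj x y \<or> adj y x"
proof -
  have no: "\<not> (valid (Up a b) \<and> valid (Hx (a + 1) b))"
    "\<not> (valid (Dn (a - 1) (b + 1)) \<and> valid (Hx (a - 1) (b + 1)))"
    "\<not> (valid (Hx (a + 1) b) \<and> valid (Hx (a - 1) (b + 1)))"
    by (simp, presburger)+
  have "x \<in> {Up a b, Dn (a - 1) (b + 1), Hx (a + 1) b, Hx (a - 1) (b + 1)}"
    "y \<in> {Up a b, Dn (a - 1) (b + 1), Hx (a + 1) b, Hx (a - 1) (b + 1)}"
    using assms(4) by (intro nodes_at_edge_2; simp)+
  moreover have "valid (Hx (a + 1) b) \<Longrightarrow>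
      adj (Dn (a - 1) (b + 1)) (Hx (a + 1) b) \<or> adj (Hx (a + 1) b) (Dn (a - 1) (b + 1))"
    using adj_Hx(5)[of "a - 1" "b + 1"] by (simp add: algebra_simps)
  ultimately show ?thesis
    using assms(1-3) no adj_Up_Dn_left[of a b] adj_Hx(2)[of a b]
    by (elim insertE emptyE; metis)
qed

lemma adj_if_share_edge_3:
  assumes "valid x" "valid y" "x \<noteq> y" "{(a, b), (a - 1, b + 1)} \<subseteq> face x \<inter> face y"
  shows "adj x y \<or> adj y x"
proof -
  have no: "\<not> (valid (Up (a - 1) b) \<and> valid (Hx (a - 1) b))"
    "\<not> (valid (Dn (a - 1) (b + 1)) \<and> valid (Hx a (b + 1)))"
    "\<not> (valid (Hx (a - 1) b) \<and> valid (Hx a (b + 1)))"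
    by (simp, presburger)+
  have "x \<in> {Up (a - 1) b, Dn (a - 1) (b + 1), Hx (a - 1) b, Hx a (b + 1)}"
    "y \<in> {Up (a - 1) b, Dn (a - 1) (b + 1), Hx (a - 1) b, Hx a (b + 1)}"
    using assms(4) by (intro nodes_at_edge_3; simp)+
  moreover have "valid (Hx a (b + 1)) \<Longrightarrow>
      adj (Up (a - 1) b) (Hx a (b + 1)) \<or> adj (Hx a (b + 1)) (Up (a - 1) b)"
    using adj_Hx(3)[of "a - 1" b] by simp
  moreover have "valid (Hx (a - 1) b) \<Longrightarrow>
      adj (Dn (a - 1) (b + 1)) (Hx (a - 1) b) \<or> adj (Hx (a - 1) b) (Dn (a - 1) (b + 1))"
    using adj_Hx(6)[of "a - 1" "b + 1"] by simp
  ultimately show ?thesis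
    using assms(1-3) no adj_Up_Dn_top[of "a - 1" b]
    by (elim insertE emptyE; metis)
qed

lemma adj_if_share_edge:
  assumes "valid x" "valid y" "face x \<noteq> face y" "e \<in> snub_edges" "e \<subseteq> face x" "e \<subseteq> face y"
  shows "adj x y \<or> adj y x"
proof -
  obtain p q where e: "e = {p, q}" "tri_adj p q" using assms(4) by (auto simp: snub_edges_def)
  obtain a b where p: "p = (a, b)" by (cases p)
  have q: "q \<in> {(a + 1, b), (a, b + 1), (a - 1, b + 1), (a - 1, b), (a, b - 1), (a + 1, b - 1)}"
    using tri_adj_cases[OF e(2)[unfolded p]] .
  have sub: "{p, q} \<subseteq> face x \<inter> face y" using assms(5,6) e(1) by simp
  have ne: "x \<noteq> y" using assms(3) by blast
  from q consider "q = (a + 1, b)" | "q = (a, b + 1)" | "q = (a - 1, b + 1)"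
    | "q = (a - 1, b)" | "q = (a, b - 1)" | "q = (a + 1, b - 1)" by blast
  then show ?thesis
  proof cases
    case 1
    with sub p show ?thesis by (intro adj_if_share_edge_1[OF assms(1,2) ne, of "a" "b"]) auto
  next
    case 2
    with sub p show ?thesis by (intro adj_if_share_edge_2[OF assms(1,2) ne, of "a" "b"]) auto
  next
    case 3
    with sub p show ?thesis by (intro adj_if_share_edge_3[OF assms(1,2) ne, of "a" "b"]) auto
  next
    case 4
    with sub p show ?thesis by (intro adj_if_share_edge_1[OF assms(1,2) ne, of "a - 1" "b"]) auto
  next
    case 5
    with sub p show ?thesis by (intro adj_if_share_edge_2[OF assms(1,2) ne, of "a" "b - 1"]) auto
  next
    case 6
    with sub p show ?thesis by (intro adj_if_share_edge_3[OF assms(1,2) ne, of "a + 1" "b - 1"]) auto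
  qed
qed

section \<open>The linear order of hexagons and \<open>B\<close>-triangles\<close>

text \<open>Summing prescribed differences in both directions from \<open>0\<close> gives heights
  along a row; this is why any orientation of the zigzag path is acyclic.\<close>

lemma ex_int_potential:
  fixes d :: "int \<Rightarrow> int"
  shows "\<exists>P. \<forall>i. P (i + 1) = P i + d i"
proof (intro exI allI)
  define P where "P i = (\<Sum>j\<in>{0..<i}. d j) - (\<Sum>j\<in>{i..<0}. d j)" for i :: int
  fix i
  show "P (i + 1) = P i + d i"
  proof (cases "0 \<le> i")
    case True
    then have "{0..<i + 1} = insert i {0..<i}" by auto
    then show ?thesis using True by (simp add: P_def)
  next
    case False
    then have "{i..<0} = insert i {i + 1..<0}" by auto
    then show ?thesis using False by (simp add: P_def)
  qed
qed

lemma ex_height_order: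
  fixes crit :: "dir \<Rightarrow> int \<Rightarrow> int \<Rightarrow> bool"
  shows "\<exists>key :: node \<Rightarrow> int \<times> int. \<forall>k a b.
    if crit k a b then key (nodeB k a b) < key (nodeH' k a b) \<or> key (nodeB' k a b) < key (nodeH k a b)
    else key (nodeH' k a b) < key (nodeB k a b) \<and> key (nodeH k a b) < key (nodeB' k a b)"
proof -
  define sg :: "dir \<Rightarrow> int \<Rightarrow> int \<Rightarrow> int" where "sg k a b = (if crit k a b then - 1 else 1)" for k a b
  text \<open>A row consists of the hexagons with \<open>2 * a - b = r\<close>, consecutive ones differing by
    \<open>(1, 2)\<close> and having a common \<open>B'\<close> in the directions \<open>Be\<close> and \<open>Al\<close>.\<close>
  define d where "d r i = sg Be (i + 1) (2 * i - r) - sg Al (i - 1) (2 * i - r + 3)" for r i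
  have "\<forall>r. \<exists>P. \<forall>i. P (i + 1) = P i + d r i"
    using ex_int_potential by blast
  then obtain P where P: "\<And>r i. P r (i + 1) = P r i + d r i" by metis
  \<comment> \<open>The offsets \<open>5\<close> and \<open>4\<close> put each
    \<open>B\<close>-triangle into the row of the hexagons with which its order must be adjustable:
    \<open>Up\<close> hangs on one hexagon, \<open>Dn\<close> lies between two. In every group the
    other comparison is between rows \<open>7\<close> apart, with the hexagon in the lower
    one.\<close>
  define key where "key x = (case x of
      Hx a b \<Rightarrow> (2 * a - b, P (2 * a - b) a)
    | Up a b \<Rightarrow> (2 * a - b + 5, P (2 * a - b + 5) (a + 2) + sg Ga a b)
    | Dn a b \<Rightarrow> (2 * a - b + 4, P (2 * a - b + 4) (a + 1) + sg Be (a + 2) (b - 2)))" for x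
  have "if crit k a b then key (nodeB k a b) < key (nodeH' k a b) \<or> key (nodeB' k a b) < key (nodeH k a b)
    else key (nodeH' k a b) < key (nodeB k a b) \<and> key (nodeH k a b) < key (nodeB' k a b)" for k a b
  proof (cases k)
    case Al
    have "P (2 * a - b + 5) (a + 2) = P (2 * a - b + 5) (a + 1) + d (2 * a - b + 5) (a + 1)"
      using P[of _ "a + 1"] by (simp add: algebra_simps)
    moreover have "d (2 * a - b + 5) (a + 1) = sg Be (a + 2) (b - 3) - sg Al a b"
      by (simp add: d_def algebra_simps)
    ultimately show ?thesis
      by (auto simp: Al key_def less_prod_def' algebra_simps) (auto simp: sg_def)
  next
    case Be
    then show ?thesis by (auto simp: key_def less_prod_def' algebra_simps) (auto simp: sg_def)
  next
    case Ga
    then show ?thesis by (auto simp: key_def less_prod_def' algebra_simps) (auto simp: sg_def)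
  qed
  then show ?thesis by blast
qed

section \<open>Coloring one group of five edges\<close>

text \<open>True stands for \<open>N\<close>. The margin \<open>2\<close> comes from strict labels:
  if \<open>a\<close> must be near \<open>h\<close> only and \<open>a'\<close> near
  \<open>b'\<close> only, their closest choices \<open>b - t - 1\<close> and
  \<open>h' + t + 1\<close> are within \<open>t\<close> just when \<open>h' + t + 2 \<le> b\<close>.
  If instead all outer labels are \<open>N\<close> and the middle one is \<open>F\<close>, then
  \<open>b < h' + t\<close> or \<open>b' < h + t\<close> is forced.\<close>

lemma ex_path_colors:
  fixes h h' b b' m t :: int and l1 l2 l3 l4 l5 :: bool
  assumes m: "0 \<le> h" "h \<le> m" "0 \<le> h'" "h' \<le> m" "t \<le> b" "b \<le> t + m" "t \<le> b'" "b' \<le> t + m"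
    and t: "2 * m + 3 \<le> t"
    and crit: "if l1 \<and> l2 \<and> l4 \<and> l5 \<and> \<not> l3 \<or> l1 \<and> l2 \<and> l3 \<and> \<not> l4 \<and> \<not> l5 \<or> \<not> l1 \<and> \<not> l2 \<and> l3 \<and> l4 \<and> l5
      then b \<le> h' + t - 2 \<or> b' \<le> h + t - 2 else h' + t + 2 \<le> b \<and> h + t + 2 \<le> b'"
  shows "\<exists>a a'. a \<in> {- t - 1..2 * t + m + 1} \<and> a' \<in> {- t - 1..2 * t + m + 1} \<and>
    (\<bar>h - a\<bar> \<le> t \<longleftrightarrow> l1) \<and> (\<bar>a - b\<bar> \<le> t \<longleftrightarrow> l2) \<and> (\<bar>a - a'\<bar> \<le> t \<longleftrightarrow> l3) \<and>
    (\<bar>a' - b'\<bar> \<le> t \<longleftrightarrow> l4) \<and> (\<bar>a' - h'\<bar> \<le> t \<longleftrightarrow> l5)"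
proof -
  text \<open>The extreme colors that satisfy the labels of the edges from \<open>a\<close> to \<open>h\<close> and \<open>b\<close>; they lie
    near \<open>{0, t}\<close>, \<open>{- t, 0}\<close>, \<open>{t, 2 * t}\<close> and \<open>{- t, 2 * t}\<close>.\<close>
  define lo where "lo l l' h b = (if l then if l' then b - t else h - t else if l' then h + t + 1 else h - t - 1)"
    for l l' :: bool and h b :: int
  define hi where "hi l l' h b = (if l then if l' then h + t else b - t - 1 else if l' then b + t else b + t + 1)"
    for l l' :: bool and h b :: int
  let ?R = "{- t - 1..2 * t + m + 1}"
  have ends: "x \<in> ?R \<and> (\<bar>h - x\<bar> \<le> t \<longleftrightarrow> l) \<and> (\<bar>x - b\<bar> \<le> t \<longleftrightarrow> l')"
    if "x = lo l l' h b \<or> x = hi l l' h b" "0 \<le> h" "h \<le> m" "t \<le> b" "b \<le> t + m" for x l l' h b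
    using that t by (cases l; cases l') (auto simp: lo_def hi_def)
  let ?a = "lo l1 l2 h b" and ?A = "hi l1 l2 h b" and ?a' = "lo l5 l4 h' b'" and ?A' = "hi l5 l4 h' b'"
  have "(\<bar>?a - ?a'\<bar> \<le> t \<longleftrightarrow> l3) \<or> (\<bar>?A - ?A'\<bar> \<le> t \<longleftrightarrow> l3) \<or>
      (\<bar>?a - ?A'\<bar> \<le> t \<longleftrightarrow> l3) \<or> (\<bar>?A - ?a'\<bar> \<le> t \<longleftrightarrow> l3)"
  proof (cases l3)
    case True
    show ?thesis
      using m t crit unfolding lo_def hi_def
      by (cases l1; cases l2; cases l4; cases l5; simp only: True if_True if_False simp_thms; smt (verit))
  next
    case False
    show ?thesis
      using m t crit unfolding lo_def hi_def
      by (cases l1; cases l2; cases l4; cases l5; simp only: False if_True if_False simp_thms; smt (verit))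
  qed
  then obtain a a' where a: "a = ?a \<or> a = ?A"
    and a': "a' = ?a' \<or> a' = ?A'" and l3: "\<bar>a - a'\<bar> \<le> t \<longleftrightarrow> l3"
    by blast
  show ?thesis
    using ends[OF a m(1,2,5,6)] ends[OF a' m(3,4,7,8)] l3 abs_minus_commute by metis
qed

section \<open>Coloring a finite set of nodes\<close>

definition path_nodes :: "dir \<Rightarrow> int \<Rightarrow> int \<Rightarrow> node set" where
  "path_nodes k a b = {nodeH k a b, nodeB k a b, nodeB' k a b, nodeH' k a b}"

text \<open>For each direction this takes the group in which the triangle would be \<open>A\<close>
  or \<open>A'\<close>, whatever its residue. Hexagons may get the empty set because every edge has
  an end \<open>A\<close> or \<open>A'\<close>.\<close>

fun paths_through :: "node \<Rightarrow> node set" where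
  "paths_through (Hx a b) = {}"
| "paths_through (Up a b) = path_nodes Al a (b + 1) \<union> path_nodes Be (a + 1) (b - 1) \<union> path_nodes Ga (a - 1) b"
| "paths_through (Dn a b) = path_nodes Al a b \<union> path_nodes Be (a + 1) (b - 1) \<union> path_nodes Ga a (b - 1)"

lemma path_nodes_subset:
  "path_nodes k a b \<subseteq> paths_through (nodeA k a b)"
  "path_nodes k a b \<subseteq> paths_through (nodeA' k a b)"
  by (cases k; auto)+

lemma card_path_nodes: "finite (path_nodes k a b)" "card (path_nodes k a b) \<le> 4"
  unfolding path_nodes_def by (simp_all add: card_insert_if)

lemma card_paths_through: "finite (paths_through x)" "card (paths_through x) \<le> 12"
proof -
  have "card (A \<union> B \<union> C) \<le> 12" if "card A \<le> 4" "card B \<le> 4" "card C \<le> 4" for A B C :: "node set"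
    using card_Un_le[of A B] card_Un_le[of "A \<union> B" C] that by linarith
  then show "card (paths_through x) \<le> 12" by (cases x) (simp_all add: card_path_nodes)
  show "finite (paths_through x)" by (cases x) (simp_all add: card_path_nodes)
qed

lemma ex_node_coloring:
  fixes L :: "node \<Rightarrow> node \<Rightarrow> bool"
  assumes X: "finite X"
  defines "t \<equiv> 48 * int (card X) + 3"
  shows "\<exists>col. (\<forall>x\<in>X. col x \<in> {- t - 1..3 * t}) \<and>
    (\<forall>x\<in>X. \<forall>y\<in>X. adj x y \<longrightarrow> (\<bar>col x - col y\<bar> \<le> t \<longleftrightarrow> L x y))"
proof -
  \<comment> \<open>At most \<open>12\<close> heights per node of \<open>X\<close> have to be
    ranked, and ranks are doubled; hence \<open>24\<close>, and
    \<open>t = 2 * m + 3\<close>.\<close>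
  define m where "m = 24 * int (card X)"
  have tm: "2 * m + 3 \<le> t" by (simp add: t_def m_def)
  define crit where "crit k a b =
    (let l1 = L (nodeH k a b) (nodeA k a b); l2 = L (nodeA k a b) (nodeB k a b); l3 = L (nodeA k a b) (nodeA' k a b);
         l4 = L (nodeA' k a b) (nodeB' k a b); l5 = L (nodeA' k a b) (nodeH' k a b)
     in l1 \<and> l2 \<and> l4 \<and> l5 \<and> \<not> l3 \<or> l1 \<and> l2 \<and> l3 \<and> \<not> l4 \<and> \<not> l5 \<or> \<not> l1 \<and> \<not> l2 \<and> l3 \<and> l4 \<and> l5)" for k a b
  obtain key :: "node \<Rightarrow> int \<times> int" where key: "\<And>k a b.
    if crit k a b then key (nodeB k a b) < key (nodeH' k a b) \<or> key (nodeB' k a b) < key (nodeH k a b)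
    else key (nodeH' k a b) < key (nodeB k a b) \<and> key (nodeH k a b) < key (nodeB' k a b)"
    using ex_height_order[of crit] by blast
  \<comment> \<open>Groups are colored as a whole, so \<open>W\<close> may contain nodes outside
    \<open>X\<close>.\<close>
  define W where "W = (\<Union>x\<in>X. paths_through x)"
  have finW: "finite W" unfolding W_def using X by (simp add: card_paths_through)
  have "card W \<le> (\<Sum>x\<in>X. card (paths_through x))" unfolding W_def by (rule card_UN_le[OF X])
  also have "\<dots> \<le> card X * 12" using sum_bounded_above[of X "\<lambda>x. card (paths_through x)" 12] card_paths_through by simp
  finally have cardW: "2 * int (card W) \<le> m" by (simp add: m_def)
  \<comment> \<open>Doubling the rank turns a strict inequality of keys into the required gap of
    \<open>2\<close>.\<close>
  define rk where "rk x = 2 * int (card {w \<in> W. key w < key x})" for x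
  have rk: "0 \<le> rk x" "rk x \<le> m" for x
    using card_mono[OF finW, of "{w \<in> W. key w < key x}"] cardW by (auto simp: rk_def)
  have rk_less: "rk x \<le> rk y - 2" if "key x < key y" "x \<in> W" for x y
  proof -
    have "{w \<in> W. key w < key x} \<subset> {w \<in> W. key w < key y}" using that by auto
    then have "card {w \<in> W. key w < key x} < card {w \<in> W. key w < key y}"
      using finW by (intro psubset_card_mono) auto
    then show ?thesis by (simp add: rk_def)
  qed
  define good where "good k a b c c' \<longleftrightarrow> c \<in> {- t - 1..2 * t + m + 1} \<and> c' \<in> {- t - 1..2 * t + m + 1} \<and>
    (\<bar>rk (nodeH k a b) - c\<bar> \<le> t \<longleftrightarrow> L (nodeH k a b) (nodeA k a b)) \<and>
    (\<bar>c - (t + rk (nodeB k a b))\<bar> \<le> t \<longleftrightarrow> L (nodeA k a b) (nodeB k a b)) \<and>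
    (\<bar>c - c'\<bar> \<le> t \<longleftrightarrow> L (nodeA k a b) (nodeA' k a b)) \<and>
    (\<bar>c' - (t + rk (nodeB' k a b))\<bar> \<le> t \<longleftrightarrow> L (nodeA' k a b) (nodeB' k a b)) \<and>
    (\<bar>c' - rk (nodeH' k a b)\<bar> \<le> t \<longleftrightarrow> L (nodeA' k a b) (nodeH' k a b))" for k a b c c'
  have "\<exists>c c'. good k a b c c'" if W: "path_nodes k a b \<subseteq> W" for k a b
  proof -
    have in_W: "nodeH k a b \<in> W" "nodeB k a b \<in> W" "nodeB' k a b \<in> W" "nodeH' k a b \<in> W"
      using W by (simp_all add: path_nodes_def)
    have "if crit k a b
      then t + rk (nodeB k a b) \<le> rk (nodeH' k a b) + t - 2 \<or> t + rk (nodeB' k a b) \<le> rk (nodeH k a b) + t - 2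
      else rk (nodeH' k a b) + t + 2 \<le> t + rk (nodeB k a b) \<and> rk (nodeH k a b) + t + 2 \<le> t + rk (nodeB' k a b)"
    proof (cases "crit k a b")
      case True
      then have "key (nodeB k a b) < key (nodeH' k a b) \<or> key (nodeB' k a b) < key (nodeH k a b)"
        using key[of k a b] by simp
      then show ?thesis using True rk_less in_W by fastforce
    next
      case False
      then have "key (nodeH' k a b) < key (nodeB k a b)" "key (nodeH k a b) < key (nodeB' k a b)"
        using key[of k a b] by simp_all
      then show ?thesis using False rk_less in_W by fastforce
    qed
    then show ?thesis
      unfolding good_def crit_def Let_def using rk tm by (intro ex_path_colors) auto
  qed
  then have "\<forall>k a b. \<exists>c c'. path_nodes k a b \<subseteq> W \<longrightarrow> good k a b c c'" by blast
  then obtain f f' where f: "\<And>k a b. path_nodes k a b \<subseteq> W \<Longrightarrow> good k a b (f k a b) (f' k a b)"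
    by metis
  \<comment> \<open>The residue determines the type and, for \<open>A\<close> and \<open>A'\<close>,
    the direction of the only group through the node, so colors from different groups never
    conflict. The last branches are meant for residue \<open>2\<close> (\<open>Up\<close>) and
    \<open>4\<close> (\<open>Dn\<close>).\<close>
  define col where "col x = (case x of Hx a b \<Rightarrow> rk (Hx a b)
    | Up a b \<Rightarrow> (let v = (a + 3 * b) mod 7 in if v = 1 then t + rk (Up a b) else if v = 5 then f' Al a (b + 1)
        else if v = 3 then f' Be (a + 1) (b - 1) else f' Ga (a - 1) b)
    | Dn a b \<Rightarrow> (let v = (a + 3 * b) mod 7 in if v = 5 then t + rk (Dn a b) else if v = 1 then f Al a b
        else if v = 3 then f Be (a + 1) (b - 1) else f Ga a (b - 1)))" for x
  have col: "col (nodeH k a b) = rk (nodeH k a b)" "col (nodeH' k a b) = rk (nodeH' k a b)"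
      "col (nodeB k a b) = t + rk (nodeB k a b)" "col (nodeB' k a b) = t + rk (nodeB' k a b)"
      "col (nodeA k a b) = f k a b" "col (nodeA' k a b) = f' k a b"
    if v: "(a + 3 * b) mod 7 = 1" for k a b
  proof -
    have mods: "(a - 1 + 3 * (b + 1)) mod 7 = 3" "(a + 3 * (b + 1)) mod 7 = 4" "(a + 3 * (b - 1)) mod 7 = 5"
      "(a + 1 + 3 * b) mod 7 = 2" "(a - 2 + 3 * (b + 2)) mod 7 = 5" "(a + 1 + 3 * (b + 1)) mod 7 = 5"
      using v by presburger+
    show "col (nodeH k a b) = rk (nodeH k a b)" "col (nodeH' k a b) = rk (nodeH' k a b)"
      by (cases k; simp add: col_def)+
    show "col (nodeB k a b) = t + rk (nodeB k a b)"
      by (simp add: col_def v)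
    show "col (nodeB' k a b) = t + rk (nodeB' k a b)"
      by (cases k; simp only: nodeB'.simps col_def node.case Let_def mods; simp)
    show "col (nodeA k a b) = f k a b" "col (nodeA' k a b) = f' k a b"
      by (cases k; simp only: nodeA.simps nodeA'.simps col_def node.case Let_def mods v; simp)+
  qed
  have "\<bar>col x - col y\<bar> \<le> t \<longleftrightarrow> L x y"
    if xy: "adj x y" "x \<in> X" "y \<in> X" for x y
  proof -
    obtain k a b where v: "(a + 3 * b) mod 7 = 1" and mem:
     "(x, y) \<in> {(nodeH k a b, nodeA k a b), (nodeA k a b, nodeB k a b), (nodeA k a b, nodeA' k a b),
               (nodeA' k a b, nodeB' k a b), (nodeA' k a b, nodeH' k a b)}"
      using xy(1) unfolding adj_def by blast
    have "path_nodes k a b \<subseteq> paths_through x \<or> path_nodes k a b \<subseteq> paths_through y"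
      using mem path_nodes_subset[of k a b] by blast
    then have "path_nodes k a b \<subseteq> W" using xy unfolding W_def by blast
    note edges = f[OF this, unfolded good_def]
    show ?thesis
      using mem unfolding insert_iff empty_iff prod.inject
      by (elim disjE conjE FalseE; simp only: col[OF v]; use edges in blast)
  qed
  moreover have "col x \<in> {- t - 1..3 * t}" if "x \<in> X" for x
  proof -
    have range: "f k a b \<in> {- t - 1..3 * t} \<and> f' k a b \<in> {- t - 1..3 * t}"
      if "path_nodes k a b \<subseteq> paths_through x" for k a b
    proof -
      have "path_nodes k a b \<subseteq> W" using that \<open>x \<in> X\<close> unfolding W_def by blast
      then have "f k a b \<in> {- t - 1..2 * t + m + 1}" "f' k a b \<in> {- t - 1..2 * t + m + 1}"
        using f unfolding good_def by blast+
      then show ?thesis using tm rk[of x] by simp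
    qed
    show ?thesis
    proof (cases x)
      case (Hx a b)
      then show ?thesis using tm rk[of x] by (simp add: col_def)
    next
      case (Up a b)
      then have "f' Al a (b + 1) \<in> {- t - 1..3 * t}" "f' Be (a + 1) (b - 1) \<in> {- t - 1..3 * t}"
        "f' Ga (a - 1) b \<in> {- t - 1..3 * t}"
        using range by (simp_all add: subset_iff)
      moreover have "t + rk x \<in> {- t - 1..3 * t}" using tm rk[of x] by simp
      ultimately show ?thesis using Up by (simp only: col_def node.case Let_def split: if_split) simp
    next
      case (Dn a b)
      then have "f Al a b \<in> {- t - 1..3 * t}" "f Be (a + 1) (b - 1) \<in> {- t - 1..3 * t}"
        "f Ga a (b - 1) \<in> {- t - 1..3 * t}"
        using range by (simp_all add: subset_iff)
      moreover have "t + rk x \<in> {- t - 1..3 * t}" using tm rk[of x] by simp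
      ultimately show ?thesis using Dn by (simp only: col_def node.case Let_def split: if_split) simp
    qed
  qed
  ultimately show ?thesis by blast
qed

section \<open>Transfer to the dual lattice\<close>

theorem mainTheorem7:
  "\<exists>C::real. \<forall>V. finite V \<and> V \<subseteq> D346_verts \<longrightarrow>
     (\<exists>r t :: int. real_of_int r \<le> C * real (card V) \<and> real_of_int t \<le> C * real (card V) \<and>
        total_threshold_colorable r t V (induced_edges D346_edges V))"
\<comment> \<open>The range used below is \<open>5 * t = 240 * card V + 15\<close>, at most
  \<open>255 * card V\<close> for nonempty \<open>V\<close>.\<close>
proof (rule exI[of _ 255], intro allI impI)
  fix V assume V: "finite V \<and> V \<subseteq> D346_verts"
  show "\<exists>r t :: int. real_of_int r \<le> 255 * real (card V) \<and> real_of_int t \<le> 255 * real (card V) \<and>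
        total_threshold_colorable r t V (induced_edges D346_edges V)"
  proof (cases "V = {}")
    case True
    \<comment> \<open>The bound leaves no positive \<open>r\<close> or \<open>t\<close> here, but
      the empty coloring puts no condition on \<open>r\<close>, so \<open>0\<close> serves for
      both.\<close>
    then show ?thesis
      by (intro exI[of _ 0])
        (simp add: total_threshold_colorable_def rt_threshold_coloring_def threshold_coloring_def)
  next
    case False
    define g where "g v = (SOME x. valid x \<and> face x = v)" for v
    have g: "valid (g v)" "face (g v) = v" if "v \<in> V" for v
    proof -
      have "\<exists>x. valid x \<and> face x = v"
        using that V snub_face_is_node by (auto simp: D346_verts_def)
      then show "valid (g v)" "face (g v) = v" unfolding g_def by (metis (mono_tags, lifting) someI_ex)+
    qed
    have g_adj: "adj (g u) (g v) \<or> adj (g v) (g u)"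
      if uv: "u \<in> V" "v \<in> V" "{u, v} \<in> induced_edges D346_edges V" for u v
    proof -
      obtain x y e where xy: "{u, v} = {x, y}" "x \<noteq> y" "e \<in> snub_edges" "e \<subseteq> x" "e \<subseteq> y"
        using uv(3) by (auto simp: induced_edges_def D346_edges_def dual_edges_def)
      then have "u \<noteq> v" "e \<subseteq> u" "e \<subseteq> v" by (auto simp: doubleton_eq_iff)
      then show ?thesis using adj_if_share_edge[of "g u" "g v" e] g uv xy(3) by simp
    qed
    define t where "t = 48 * int (card V) + 3"
    have pos: "card V > 0" using V False by (simp add: card_gt_0_iff)
    have "total_threshold_colorable (5 * t) t V (induced_edges D346_edges V)"
      unfolding total_threshold_colorable_def
    proof
      fix l :: "(int \<times> int) set set \<Rightarrow> label"
      have fin: "finite (g ` V)" using V by simp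
      have "inj_on g V" using g(2) by (metis inj_onI)
      then have card: "card (g ` V) = card V" by (rule card_image)
      obtain col where col_ex: "(\<forall>x\<in>g ` V. col x \<in> {- t - 1..3 * t}) \<and> (\<forall>x\<in>g ` V. \<forall>y\<in>g ` V. adj x y \<longrightarrow>
          (\<bar>col x - col y\<bar> \<le> t \<longleftrightarrow> l {face x, face y} = N))"
        using ex_node_coloring[OF fin, of "\<lambda>x y. l {face x, face y} = N"]
        unfolding card t_def[symmetric] by (elim exE)
      have range: "col (g v) \<in> {- t - 1..3 * t}" if "v \<in> V" for v
        using col_ex that by simp
      have col: "\<bar>col (g u) - col (g v)\<bar> \<le> t \<longleftrightarrow> l {u, v} = N" if "u \<in> V" "v \<in> V" "adj (g u) (g v)" for u v
        using col_ex that g(2) by simp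
      have "threshold_coloring V (induced_edges D346_edges V) l t (col \<circ> g)"
        unfolding threshold_coloring_def
      proof (intro conjI ballI impI)
        show "0 \<le> t" by (simp add: t_def)
        fix u v assume uv: "u \<in> V" "v \<in> V" "{u, v} \<in> induced_edges D346_edges V"
        from g_adj[OF uv]
        show "\<bar>(col \<circ> g) u - (col \<circ> g) v\<bar> \<le> t \<longleftrightarrow> l {u, v} = N"
        proof
          assume "adj (g v) (g u)"
          from col[OF uv(2,1) this] show ?thesis
            by (simp only: o_apply abs_minus_commute[of "col (g u)"] insert_commute[of u])
        qed (simp only: o_apply col[OF uv(1,2)])
      qed
      \<comment> \<open>The colors span at most \<open>4 * t + 1\<close>, and
        \<open>t > 1\<close>.\<close>
      moreover have "Max ((col \<circ> g) ` V) - Min ((col \<circ> g) ` V) < 5 * t"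
      proof -
        have "Max ((col \<circ> g) ` V) \<le> 3 * t" "- t - 1 \<le> Min ((col \<circ> g) ` V)"
          using V False range by simp_all
        then show ?thesis by (simp add: t_def)
      qed
      ultimately show "\<exists>c. rt_threshold_coloring (5 * t) t V (induced_edges D346_edges V) l c"
        unfolding rt_threshold_coloring_def by blast
    qed
    moreover have "real_of_int (5 * t) \<le> 255 * real (card V)" "real_of_int t \<le> 255 * real (card V)"
      using pos by (simp_all add: t_def)
    ultimately show ?thesis by blast
  qed
qed

end
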